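(* Suppose $\mathfrak{C}_{AR(1)}\subseteq\mathfrak{C}$. Fix $(R,r)$ with $\operatorname{rank}(R)=q$, fix $0<C<\infty$, and fix admissible weights $w(j,n)$. 1. Define $\mathfrak{X}_0=\{X\in\mathbb{R}^{n\times k}:\operatorname{rank}(X)=k\}$, and for $e\in\{e_+,e_-\}$ define $\mathfrak{X}_1(e)=\{X\in\mathfrak{X}_0:\operatorname{rank}(B_X(e))<q\}$ and $\mathfrak{X}_2(e)=\{X\in\mathfrak{X}_0\setminus\mathfrak{X}_1(e):T_X(e+\mu_0^* )=C\}$, where $\mu_0^*\in\mathfrak{M}_{0,X}$ is arbitrary (the set $\mathfrak{X}_2(e)$ does not depend on the choice of $\mu_0^*$). Then $\mathfrak{X}_1(e_+),\mathfrak{X}_2(e_+),\mathfrak{X}_1(e_-),\mathfrak{X}_2(e_-)$ are $\lambda_{\mathbb{R}^{n\times k}}$-null sets. The set of all $X\in\mathfrak{X}_0$ which are not covered is a subset of $(\mathfrak{X}_1(e_+)\cup\mathfrak{X}_2(e_+))\cap(\mathfrak{X}_1(e_-)\cup\mathfrak{X}_2(e_-))$ and hence is a $\lambda_{\mathbb{R}^{n\times k}}$-null set; moreover $\mathfrak{X}_0$ differs from $\mathbb{R}^{n\times k}$ only by a $\lambda_{\mathbb{R}^{n\times k}}$-null set. 2. Suppose $k\ge2$, $X$ is of the form $X=(e_+,\tilde X)$, and the first column of $R$ consists of zeros only. Define $\tilde{\mathfrak{X}}_0=\{\tilde X\in\mathbb{R}^{n\times(k-1)}:\operatorname{rank}((e_+,\tilde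 X))=k\}$, and for $e\in\{e_+,e_-\}$ define $\tilde{\mathfrak{X}}_1(e)=\{\tilde X\in\tilde{\mathfrak{X}}_0:\operatorname{rank}(B_{(e_+,\tilde X)}(e))<q\}$ and $\tilde{\mathfrak{X}}_2(e)=\{\tilde X\in\tilde{\mathfrak{X}}_0\setminus\tilde{\mathfrak{X}}_1(e):T_{(e_+,\tilde X)}(e+\mu_0^* )=C\}$, where $\mu_0^*\in\mathfrak{M}_{0,(e_+,\tilde X)}$ is arbitrary (the latter set does not depend on the choice of $\mu_0^*$). Then $\tilde{\mathfrak{X}}_1(e_-)$ and $\tilde{\mathfrak{X}}_2(e_-)$ are $\lambda_{\mathbb{R}^{n\times(k-1)}}$-null sets, while $\tilde{\mathfrak{X}}_1(e_+)=\tilde{\mathfrak{X}}_0$ and $\tilde{\mathfrak{X}}_2(e_+)=\emptyset$. The set of all $\tilde X\in\tilde{\mathfrak{X}}_0$ such that $X=(e_+,\tilde X)$ is not covered is a subset of $\tilde{\mathfrak{X}}_1(e_-)\cup\tilde{\mathfrak{X}}_2(e_-)$ and hence is a $\lambda_{\mathbb{R}^{n\times(k-1)}}$-null set; moreover $\tilde{\mathfrak{X}}_0$ differs from $\mathbb{R}^{n\times(k-1)}$ only by a $\lambda_{\mathbb{R}^{n\times(k-1)}}$-null set. 3. Suppose $k\ge2$, $X=(e_+,\tilde X)$, and the first column of $R$ is nonzero. Then $X=(e_+,\tilde X)$ is covered for every $\tilde X\in\tilde{\mathfrak{X}}_0$ (with $\tilde{\mathfrak{X}}_0$ as defined in item 2),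 provided $(X,R)$ satisfies the rank condition.
   Context: $n,k,q$ are integers with $1\le k<n$, $q\ge1$; $R$ is a real $q\times k$ matrix of rank $q$, $r\in\mathbb{R}^q$. $\mathfrak{C}$ is a nonempty set of symmetric positive definite $n\times n$ matrices (such that $\sigma^2\in(0,\infty)$ and $\Sigma\in\mathfrak{C}$ are uniquely determined by $\sigma^2\Sigma$); $\Lambda(\rho)=(\rho^{|i-j|})_{i,j=1}^n$ and $\mathfrak{C}_{AR(1)}=\{\Lambda(\rho):\rho\in(-1,1)\}$. $\lambda_{\mathbb{R}^{m}}$ (and $\lambda_{\mathbb{R}^{n\times k}}$) denotes Lebesgue measure. $e_+=(1,\dots,1)'$, $e_-=(-1,1,\dots,(-1)^n)'$ in $\mathbb{R}^n$; $e_i(n)$ is the $i$-th standard basis vector. For $X\in\mathbb{R}^{n\times k}$ of rank $k$: $\mathfrak{M}_{0,X}=\{X\beta:\beta\in\mathbb{R}^k,\ R\beta=r\}$; $\hat\beta_X(y)=(X'X)^{-1}X'y$; $\hat u(y)=y-X\hat\beta_X(y)$ with coordinates $\hat u_t(y)$; $x_{t\cdot}$ is the $t$-th row of $X$; $\hat v_t(y)=\hat u_t(y)x_{t\cdot}'$; $\hat\Gamma_j(y)=n^{-1}\sum_{t=j+1}^n\hat v_t(y)\hat v_{t-j}(y)'$ for $j\ge0$, $\hat\Gamma_j(y)=\hat\Gamma_{-j}(y)'$ for $j<0$; $\hat\Psi_w(y)=\sum_{j=-(n-1)}^{n-1}w(j,n)\hat\Gamma_j(y)$; $\hat\Omega_{w,X}(y)=nR(X'X)^{-1}\hat\Psi_w(y)(X'X)^{-1}R'$;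 $T_X(y)=(R\hat\beta_X(y)-r)'\hat\Omega_{w,X}^{-1}(y)(R\hat\beta_X(y)-r)$ if $\det\hat\Omega_{w,X}(y)\ne0$ and $T_X(y)=0$ otherwise; $B_X(y)=R(X'X)^{-1}X'\operatorname{diag}(\hat u_1(y),\dots,\hat u_n(y))$. The data-independent real weights $w(j,n)$, $|j|\le n-1$, are admissible if $w(0,n)=1$, $w(-j,n)=w(j,n)$ and the Toeplitz matrix $(w(i-j,n))_{i,j=1}^n$ is positive definite. Rank condition on $(X,R)$: let $i_1<\dots<i_s$ be all indices $i$ with $e_i(n)\in\operatorname{span}(X)$ ($s=0$ if there are none) and let $X'(\neg(i_1,\dots,i_s))$ be $X'$ with these columns deleted; then $\operatorname{rank}(R(X'X)^{-1}X'(\neg(i_1,\dots,i_s)))=q$. Covered: a matrix $X\in\mathbb{R}^{n\times k}$ of rank $k$ is called covered (i.e. the paper's theorem establishing size one or infimal power zero of the test rejecting for $T_X\ge C$ applies to $X$) if $(X,R)$ satisfies the rank condition and for at least one $e\in\{e_+,e_-\}$ one of the following holds: (i) $\operatorname{rank}(B_X(e))=q$ and $T_X(e+\mu_0^* )>C$ for some (equivalently all) $\mu_0^*\in\mathfrak{M}_{0,X}$; (ii) $\operatorname{rank}(B_X(e))=q$ and $T_X(e+\mu_0^* )<C$ for some (equivalently all) $\mu_0^*\in\mathfrak{M}_{0,X}$; (iii) $B_X(e)=0$ and $R\hat\beta_X(e)\ne0$. *)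

theory Defs
  imports "HOL-Analysis.Analysis"
begin

text \<open>
  Vectors and matrices are indexed by finite types, so \<^term>\<open>n\<close>, \<^term>\<open>k\<close>, \<^term>\<open>q\<close> are the
  cardinalities of the index types.  Row indices (time) and column indices are moreover linearly
  ordered; \<open>pos\<close> and \<open>idx\<close> are the mutually inverse order isomorphisms between such a
  type and \<open>{1, ..., CARD}\<close>.
\<close>

text \<open>\<open>('n, 'k) rmat\<close> is the type of real matrices with rows \<open>'n\<close> and columns \<open>'k\<close>.
  It is written with \<open>vec\<close> because the notation \<open>real^'n\<close> would force the sort of \<open>'n\<close>
  to be exactly \<open>finite\<close>.\<close>

type_synonym 'n rvec = "(real, 'n) vec"
type_synonym ('n, 'k) rmat = "((real, 'k) vec, 'n) vec"

definition pos :: "'a::{finite,linorder} \<Rightarrow> nat" where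
  "pos i = card {j. j \<le> i}"

definition idx :: "nat \<Rightarrow> 'a::{finite,linorder}" where
  "idx m = (THE i. pos i = m)"

lemma pos_strict_mono: "i < j \<Longrightarrow> pos i < pos j"
proof -
  assume "i < j"
  then have "j \<in> {k. k \<le> j}" "j \<notin> {k. k \<le> i}" "{k. k \<le> i} \<subseteq> {k. k \<le> j}"
    by auto
  then have "{k. k \<le> i} \<subset> {k. k \<le> j}" by blast
  then show ?thesis unfolding pos_def by (rule psubset_card_mono[rotated]) simp
qed

lemma pos_inj: "inj pos"
proof (rule injI)
  fix i j :: 'a
  assume "pos i = pos j"
  then show "i = j"
    using pos_strict_mono[of i j] pos_strict_mono[of j i] by (cases i j rule: linorder_cases) simp_all
qed

lemma pos_bij: "bij_betw (pos :: 'a::{finite,linorder} \<Rightarrow> nat) UNIV {1..CARD('a)}"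
proof -
  have "pos i \<in> {1..CARD('a)}" for i :: 'a
  proof -
    have "card {i} \<le> pos i"
      unfolding pos_def by (rule card_mono) simp_all
    moreover have "pos i \<le> CARD('a)"
      unfolding pos_def by (rule card_mono) simp_all
    ultimately show ?thesis by simp
  qed
  then have "range (pos :: 'a \<Rightarrow> nat) = {1..CARD('a)}"
    using card_subset_eq[of "{1..CARD('a)}" "range (pos :: 'a \<Rightarrow> nat)"]
    by (simp add: card_image pos_inj image_subset_iff)
  then show ?thesis by (simp add: bij_betw_def pos_inj)
qed

lemma idx_pos [simp]: "idx (pos i) = i"
  unfolding idx_def by (rule the_equality) (auto dest: injD[OF pos_inj])

lemma pos_idx: "1 \<le> m \<Longrightarrow> m \<le> CARD('a) \<Longrightarrow> pos (idx m :: 'a::{finite,linorder}) = m"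
proof -
  assume "1 \<le> m" "m \<le> CARD('a)"
  then have "m \<in> range (pos :: 'a \<Rightarrow> nat)"
    using pos_bij[where 'a = 'a] by (simp add: bij_betw_def)
  then show ?thesis by auto
qed

section \<open>Covariance models and weights\<close>

definition pos_def_mat :: "('n::finite, 'n) rmat \<Rightarrow> bool" where
  "pos_def_mat A \<longleftrightarrow> transpose A = A \<and> (\<forall>x. x \<noteq> 0 \<longrightarrow> 0 < x \<bullet> (A *v x))"

definition covariance_model :: "('n::finite, 'n) rmat set \<Rightarrow> bool" where
  "covariance_model \<CC> \<longleftrightarrow> \<CC> \<noteq> {} \<and> (\<forall>\<Sigma>\<in>\<CC>. pos_def_mat \<Sigma>) \<and>
     (\<forall>s1>0. \<forall>s2>0. \<forall>\<Sigma>1\<in>\<CC>. \<forall>\<Sigma>2\<in>\<CC>.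
        s1 *\<^sub>R \<Sigma>1 = s2 *\<^sub>R \<Sigma>2 \<longrightarrow> s1 = s2 \<and> \<Sigma>1 = \<Sigma>2)"

definition ar1_mat :: "real \<Rightarrow> ('n::{finite,linorder}, 'n) rmat" where
  "ar1_mat \<rho> = (\<chi> i j. \<rho> ^ nat \<bar>int (pos i) - int (pos j)\<bar>)"

definition ar1_model :: "('n::{finite,linorder}, 'n) rmat set" where
  "ar1_model = {ar1_mat \<rho> | \<rho>. -1 < \<rho> \<and> \<rho> < 1}"

text \<open>The sample size is fixed, so \<open>w(j,n)\<close> is written \<open>w j\<close>; only the values for
  \<open>|j| < n\<close> matter.  The type argument carries the sample size.\<close>

definition admissible_weights :: "'n::{finite,linorder} itself \<Rightarrow> (int \<Rightarrow> real) \<Rightarrow> bool" where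
  "admissible_weights _ w \<longleftrightarrow> w 0 = 1 \<and>
     (\<forall>j. \<bar>j\<bar> \<le> int CARD('n) - 1 \<longrightarrow> w (- j) = w j) \<and>
     pos_def_mat ((\<chi> i j. w (int (pos i) - int (pos j))) :: ('n, 'n) rmat)"

definition e_plus :: "'n::finite rvec" where
  "e_plus = (\<chi> i. 1)"

definition e_minus :: "'n::{finite,linorder} rvec" where
  "e_minus = (\<chi> i. (-1) ^ pos i)"

section \<open>The test statistic\<close>

definition M0 :: "('n::finite, 'k::finite) rmat \<Rightarrow> ('q::finite, 'k) rmat \<Rightarrow> 'q rvec \<Rightarrow> 'n rvec set" where
  "M0 X R r = {X *v \<beta> | \<beta>. R *v \<beta> = r}"

definition beta_hat :: "('n::finite, 'k::finite) rmat \<Rightarrow> 'n rvec \<Rightarrow> 'k rvec" where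
  "beta_hat X y = (matrix_inv (transpose X ** X) ** transpose X) *v y"

definition u_hat :: "('n::finite, 'k::finite) rmat \<Rightarrow> 'n rvec \<Rightarrow> 'n rvec" where
  "u_hat X y = y - X *v beta_hat X y"

definition v_hat :: "('n::finite, 'k::finite) rmat \<Rightarrow> 'n rvec \<Rightarrow> 'n \<Rightarrow> 'k rvec" where
  "v_hat X y t = (u_hat X y $ t) *\<^sub>R row t X"

definition outer :: "'k::finite rvec \<Rightarrow> 'k rvec \<Rightarrow> ('k, 'k) rmat" where
  "outer v u = (columnvector v :: ('k, 1) rmat) ** rowvector u"

definition Gamma_hat_nonneg ::
  "('n::{finite,linorder}, 'k::finite) rmat \<Rightarrow> 'n rvec \<Rightarrow> nat \<Rightarrow> ('k, 'k) rmat" where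
  "Gamma_hat_nonneg X y j =
     (1 / real CARD('n)) *\<^sub>R
       (\<Sum>t = j + 1..CARD('n). outer (v_hat X y (idx t)) (v_hat X y (idx (t - j))))"

definition Gamma_hat ::
  "('n::{finite,linorder}, 'k::finite) rmat \<Rightarrow> 'n rvec \<Rightarrow> int \<Rightarrow> ('k, 'k) rmat" where
  "Gamma_hat X y j =
     (if j \<ge> 0 then Gamma_hat_nonneg X y (nat j)
      else transpose (Gamma_hat_nonneg X y (nat (- j))))"

definition Psi_hat ::
  "(int \<Rightarrow> real) \<Rightarrow> ('n::{finite,linorder}, 'k::finite) rmat \<Rightarrow> 'n rvec \<Rightarrow> ('k, 'k) rmat" where
  "Psi_hat w X y =
     (\<Sum>j = - (int CARD('n) - 1)..int CARD('n) - 1. w j *\<^sub>R Gamma_hat X y j)"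

definition Omega_hat ::
  "(int \<Rightarrow> real) \<Rightarrow> ('q::finite, 'k::finite) rmat \<Rightarrow> ('n::{finite,linorder}, 'k) rmat \<Rightarrow> 'n rvec
    \<Rightarrow> ('q, 'q) rmat" where
  "Omega_hat w R X y =
     real CARD('n) *\<^sub>R
       (R ** matrix_inv (transpose X ** X) ** Psi_hat w X y **
        matrix_inv (transpose X ** X) ** transpose R)"

definition T_stat ::
  "(int \<Rightarrow> real) \<Rightarrow> ('q::finite, 'k::finite) rmat \<Rightarrow> 'q rvec \<Rightarrow> ('n::{finite,linorder}, 'k) rmat
    \<Rightarrow> 'n rvec \<Rightarrow> real" where
  "T_stat w R r X y =
     (if det (Omega_hat w R X y) \<noteq> 0
      then (R *v beta_hat X y - r) \<bullet> (matrix_inv (Omega_hat w R X y) *v (R *v beta_hat X y - r))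
      else 0)"

definition diag_mat :: "'n::finite rvec \<Rightarrow> ('n, 'n) rmat" where
  "diag_mat u = (\<chi> i j. if i = j then u $ i else 0)"

definition B_mat ::
  "('q::finite, 'k::finite) rmat \<Rightarrow> ('n::finite, 'k) rmat \<Rightarrow> 'n rvec \<Rightarrow> ('q, 'n) rmat" where
  "B_mat R X y =
     R ** matrix_inv (transpose X ** X) ** transpose X ** diag_mat (u_hat X y)"

section \<open>Rank condition and coverage\<close>

text \<open>Deleting columns would change the index type, so the rank of the matrix with the columns
  in \<open>I\<close> deleted is expressed as the dimension of the span of the remaining columns
  (compare \<open>column_rank_def\<close>).  Deleting columns of \<open>X'\<close> before or after multiplying by
  \<open>R(X'X)\<^sup>-\<^sup>1\<close> from the left is the same.\<close>

definition rank_del_columns :: "('q::finite, 'n::finite) rmat \<Rightarrow> 'n set \<Rightarrow> nat" where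
  "rank_del_columns A I = dim {column i A | i. i \<notin> I}"

definition rank_condition :: "('n::finite, 'k::finite) rmat \<Rightarrow> ('q::finite, 'k) rmat \<Rightarrow> bool" where
  "rank_condition X R \<longleftrightarrow>
     rank_del_columns (R ** matrix_inv (transpose X ** X) ** transpose X)
       {i. axis i 1 \<in> span (columns X)} = CARD('q)"

text \<open>The conditions on \<open>T_stat\<close> are stated for some \<open>\<mu>\<close> in \<open>M0\<close>, so they cannot hold
  vacuously.\<close>

definition covered ::
  "(int \<Rightarrow> real) \<Rightarrow> ('q::finite, 'k::finite) rmat \<Rightarrow> 'q rvec \<Rightarrow> real
    \<Rightarrow> ('n::{finite,linorder}, 'k) rmat \<Rightarrow> bool" where
  "covered w R r C X \<longleftrightarrow> rank X = CARD('k) \<and> rank_condition X R \<and>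
     (\<exists>e \<in> {e_plus, e_minus}.
        (rank (B_mat R X e) = CARD('q) \<and> (\<exists>\<mu> \<in> M0 X R r. T_stat w R r X (e + \<mu>) > C)) \<or>
        (rank (B_mat R X e) = CARD('q) \<and> (\<exists>\<mu> \<in> M0 X R r. T_stat w R r X (e + \<mu>) < C)) \<or>
        (B_mat R X e = 0 \<and> R *v beta_hat X e \<noteq> 0))"

section \<open>The exceptional sets of design matrices\<close>

definition XX0 :: "('n::finite, 'k::finite) rmat set" where
  "XX0 = {X. rank X = CARD('k)}"

definition XX1 :: "('q::finite, 'k::finite) rmat \<Rightarrow> 'n::finite rvec \<Rightarrow> ('n, 'k) rmat set" where
  "XX1 R e = {X \<in> XX0. rank (B_mat R X e) < CARD('q)}"

text \<open>\<open>XX2\<close> and \<open>XXt2\<close> use "some \<open>\<mu>\<close>" in \<open>M0\<close>; that "all \<open>\<mu>\<close>" gives the same set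
  expresses the independence of the choice of \<open>\<mu>\<close>, since the set obtained from any choice
  lies between the two.\<close>

definition XX2 ::
  "(int \<Rightarrow> real) \<Rightarrow> ('q::finite, 'k::finite) rmat \<Rightarrow> 'q rvec \<Rightarrow> real \<Rightarrow> 'n::{finite,linorder} rvec
    \<Rightarrow> ('n, 'k) rmat set" where
  "XX2 w R r C e = {X \<in> XX0 - XX1 R e. \<exists>\<mu> \<in> M0 X R r. T_stat w R r X (e + \<mu>) = C}"

text \<open>\<open>with_ones Xt\<close> is the matrix \<open>(e\<^sub>+, Xt)\<close>; it is meaningful only if
  \<open>CARD('k) = CARD('m) + 1\<close>.\<close>

definition with_ones ::
  "('n::finite, 'm::{finite,linorder}) rmat \<Rightarrow> ('n, 'k::{finite,linorder}) rmat" where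
  "with_ones Xt = (\<chi> i j. if pos j = 1 then 1 else Xt $ i $ idx (pos j - 1))"

text \<open>The type argument of \<open>XXt0\<close> is the column index type of \<open>(e\<^sub>+, Xt)\<close>.\<close>

definition XXt0 :: "'k::{finite,linorder} itself \<Rightarrow> ('n::finite, 'm::{finite,linorder}) rmat set" where
  "XXt0 _ = {Xt. rank (with_ones Xt :: ('n, 'k) rmat) = CARD('k)}"

definition XXt1 ::
  "('q::finite, 'k::{finite,linorder}) rmat \<Rightarrow> 'n::finite rvec
    \<Rightarrow> ('n, 'm::{finite,linorder}) rmat set" where
  "XXt1 R e = {Xt \<in> XXt0 TYPE('k). rank (B_mat R (with_ones Xt) e) < CARD('q)}"

definition XXt2 ::
  "(int \<Rightarrow> real) \<Rightarrow> ('q::finite, 'k::{finite,linorder}) rmat \<Rightarrow> 'q rvec \<Rightarrow> real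
    \<Rightarrow> 'n::{finite,linorder} rvec \<Rightarrow> ('n, 'm::{finite,linorder}) rmat set" where
  "XXt2 w R r C e =
     {Xt \<in> XXt0 TYPE('k) - XXt1 R e.
        \<exists>\<mu> \<in> M0 (with_ones Xt) R r. T_stat w R r (with_ones Xt) (e + \<mu>) = C}"

end

theory Submission
  imports Defs "HOL-Analysis.Analysis"
begin

text \<open>
  Fix \<open>e\<close> and put \<open>z = R \<beta>\<close>, where \<open>\<beta>\<close> is the least squares coefficient of \<open>e\<close> on \<open>X\<close>.
  Adding an element of the null hypothesis space to \<open>e\<close> changes neither \<open>B\<close> nor the centred
  estimate \<open>z\<close>, so the test statistic there is \<open>z' \<Omega>\<^sup>-\<^sup>1 z\<close> irrespective of the element chosen
  (\<open>T_stat_add_M0\<close>).  Moreover \<open>\<Omega> = B W B'\<close> with \<open>W\<close> the positive definite Toeplitz matrix of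
  the weights (\<open>Omega_hat_eq\<close>), so \<open>B\<close> has full rank \<open>q\<close> if and only if \<open>det \<Omega> \<noteq> 0\<close>.

  Both exceptional sets therefore lie in zero sets of \<open>det (\<Omega> - c z z')\<close>: rank deficiency of \<open>B\<close> is
  the case \<open>c = 0\<close>, and \<open>T = C\<close> forces the determinant with \<open>c = 1 / C\<close> to vanish, because
  \<open>\<Omega>\<^sup>-\<^sup>1 z\<close> is then in the kernel (\<open>det_bordered_eq_0\<close>).  These determinants are rational in the
  entries of \<open>X\<close> with powers of \<open>det (X' X)\<close> as denominators, and the zero set of a nonzero
  polynomial is a null set (\<open>negligible_polynomial_zeros\<close>).  What remains is one full-rank design at
  which they do not vanish.  A design with \<open>z = 0\<close> and without zero residuals serves for both values
  of \<open>c\<close> (\<open>negligible_exceptional_designs\<close>): orthonormal columns orthogonal to \<open>e\<close>, or, when the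
  first column has to be constant and the first column of \<open>R\<close> is zero, further columns that are
  orthonormal and orthogonal to both \<open>e_plus\<close> and \<open>e_minus\<close>, with \<open>e = e_minus\<close>.

  A design outside the exceptional sets is covered, since full rank of \<open>B\<close> already implies the rank
  condition (\<open>rank_condition_if_B_mat_full_rank\<close>).  If \<open>e_plus\<close> is a column of \<open>X\<close>, its residual is
  zero, so \<open>B = 0\<close>, and \<open>z\<close> is the first column of \<open>R\<close>; this explains the different role of
  \<open>e_plus\<close> for designs with an intercept.
\<close>

section \<open>Zero sets of polynomials and of rational functions\<close>

text \<open>A Fubini argument in the coordinates \<open>(x, t) \<mapsto> a + t x\<close>: every ray meets \<open>S\<close> in a null set
  of parameters \<open>t\<close>, so for almost every \<open>t\<close> the set of \<open>x\<close> with \<open>a + t x \<in> S\<close> is null.  One such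
  \<open>t \<noteq> 0\<close> suffices, because \<open>S\<close> is an affine image of that set.\<close>

lemma negligible_if_countable_on_rays:
  fixes S :: "'a::euclidean_space set"
  assumes "closed S" and rays: "\<And>x. countable {t::real. a + t *\<^sub>R x \<in> S}"
  shows "negligible S"
proof -
  have "open {z :: 'a \<times> real. a + snd z *\<^sub>R fst z \<in> - S}"
    using open_vimage[of "- S" "\<lambda>z :: 'a \<times> real. a + snd z *\<^sub>R fst z"] assms(1)
    by (simp add: vimage_def open_Compl continuous_intros)
  then have meas: "{z \<in> space (lborel \<Otimes>\<^sub>M lborel). a + snd z *\<^sub>R fst z \<notin> S}
      \<in> sets (lborel \<Otimes>\<^sub>M lborel :: ('a \<times> real) measure)"
    unfolding lborel_prod by (simp add: borel_open)
  have "AE x in (lborel :: 'a measure). AE t in (lborel :: real measure). a + t *\<^sub>R x \<notin> S"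
    by (intro AE_I2 AE_I'[OF countable_imp_null_set_lborel[OF rays]]) auto
  then have "AE t in (lborel :: real measure). AE x in (lborel :: 'a measure). a + t *\<^sub>R x \<notin> S"
    by (subst lborel_pair.AE_commute[OF meas, symmetric])
  moreover have "AE t in (lborel :: real measure). t \<noteq> 0"
    by (rule AE_I'[of "{0}"]) auto
  ultimately have "AE t in (lborel :: real measure).
      t \<noteq> 0 \<and> (AE x in (lborel :: 'a measure). a + t *\<^sub>R x \<notin> S)"
    by eventually_elim simp
  moreover have "ae_filter (lborel :: real measure) \<noteq> bot"
    by (simp add: ae_filter_eq_bot_iff)
  ultimately obtain t :: real where "t \<noteq> 0"
    and t: "AE x in (lborel :: 'a measure). a + t *\<^sub>R x \<notin> S"
    using eventually_happens'[of "ae_filter lborel"] by blast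
  let ?S = "{x. a + t *\<^sub>R x \<in> S}"
  have "closed ?S"
    using closed_vimage[of S "\<lambda>x. a + t *\<^sub>R x"] assms(1)
    by (simp add: vimage_def continuous_intros)
  then have "negligible ?S"
    using t AE_iff_null_sets[of ?S lborel]
    by (simp add: negligible_iff_null_sets borel_closed null_sets_completionI)
  then have "negligible ((\<lambda>x. a + t *\<^sub>R x) ` ?S)"
    by (intro negligible_differentiable_image_negligible derivative_intros) auto
  moreover have "S \<subseteq> (\<lambda>x. a + t *\<^sub>R x) ` ?S"
  proof
    fix y assume "y \<in> S"
    then show "y \<in> (\<lambda>x. a + t *\<^sub>R x) ` ?S"
      using \<open>t \<noteq> 0\<close> by (intro image_eqI[of _ _ "(1 / t) *\<^sub>R (y - a)"]) auto
  qed
  ultimately show ?thesis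
    by (rule negligible_subset)
qed

text \<open>Along each line through a point where the polynomial does not vanish it restricts to a nonzero
  polynomial in one variable, which has finitely many roots.\<close>

lemma negligible_polynomial_zeros:
  fixes p :: "'a::euclidean_space \<Rightarrow> real"
  assumes p: "real_polynomial_function p" and "p a \<noteq> 0"
  shows "negligible {x. p x = 0}"
proof (rule negligible_if_countable_on_rays)
  show "closed {x. p x = 0}"
    using p by (intro closed_Collect_eq continuous_on_const continuous_on_polymonial_function)
      (simp add: real_polynomial_function_eq)
next
  fix x
  have "polynomial_function (\<lambda>t::real. a + t *\<^sub>R x)"
    by (intro polynomial_function_add polynomial_function_const polynomial_function_bounded_linear
        bounded_linear_scaleR_left)
  from real_polynomial_function_compose[OF this p]
  obtain c n where c: "p \<circ> (\<lambda>t::real. a + t *\<^sub>R x) = (\<lambda>t. \<Sum>i\<le>n. c i * t ^ i)"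
    by (auto simp: real_polynomial_function_iff_sum)
  have "(\<Sum>i\<le>n. c i * 0 ^ i) = p a"
    using fun_cong[OF c, of 0] by simp
  then have "c 0 \<noteq> 0"
    using \<open>p a \<noteq> 0\<close> by (simp add: power_0_left if_distrib[of "\<lambda>z. _ * z"] sum.delta cong: if_cong)
  then have "finite {t. (\<Sum>i\<le>n. c i * t ^ i) = 0}"
    by (intro polyfun_roots_finite[of c 0 n]) auto
  moreover have "{t. a + t *\<^sub>R x \<in> {x. p x = 0}} = {t. (\<Sum>i\<le>n. c i * t ^ i) = 0}"
    using fun_cong[OF c] by auto
  ultimately show "countable {t. a + t *\<^sub>R x \<in> {x. p x = 0}}"
    by (simp add: countable_finite)
qed

text \<open>The statistic is rational, not polynomial, in the design matrix, and all of its denominators are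
  powers of the determinant \<open>d\<close> of the Gram matrix.  Off the zeros of \<open>d\<close> the denominators can
  be cleared; nothing is asked where \<open>d\<close> vanishes, since singular designs are excluded there.\<close>

definition rational_over :: "('a::real_normed_vector \<Rightarrow> real) \<Rightarrow> ('a \<Rightarrow> real) \<Rightarrow> bool" where
  "rational_over d f \<longleftrightarrow>
     (\<exists>p m. real_polynomial_function p \<and> (\<forall>x. d x \<noteq> 0 \<longrightarrow> f x * d x ^ m = p x))"

lemma rational_over_polynomial: "real_polynomial_function f \<Longrightarrow> rational_over d f"
  unfolding rational_over_def by (intro exI[of _ f] exI[of _ 0]) simp

lemma rational_over_const: "rational_over d (\<lambda>x. c)"
  by (intro rational_over_polynomial real_polynomial_function.intros(2))

lemma rational_over_mult:
  assumes "rational_over d f" "rational_over d g"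
  shows "rational_over d (\<lambda>x. f x * g x)"
proof -
  obtain p m q l
    where p: "real_polynomial_function p" "\<And>x. d x \<noteq> 0 \<Longrightarrow> f x * d x ^ m = p x"
      and q: "real_polynomial_function q" "\<And>x. d x \<noteq> 0 \<Longrightarrow> g x * d x ^ l = q x"
    using assms unfolding rational_over_def by metis
  from p(1) q(1) show ?thesis
    unfolding rational_over_def
    by (intro exI[of _ "\<lambda>x. p x * q x"] exI[of _ "m + l"] conjI real_polynomial_function.intros(4))
      (simp_all add: power_add mult_ac flip: p(2) q(2))
qed

lemma rational_over_add:
  assumes d: "real_polynomial_function d" and "rational_over d f" "rational_over d g"
  shows "rational_over d (\<lambda>x. f x + g x)"
proof -
  obtain p m q l
    where p: "real_polynomial_function p" "\<And>x. d x \<noteq> 0 \<Longrightarrow> f x * d x ^ m = p x"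
      and q: "real_polynomial_function q" "\<And>x. d x \<noteq> 0 \<Longrightarrow> g x * d x ^ l = q x"
    using assms unfolding rational_over_def by metis
  from p(1) q(1) show ?thesis
    unfolding rational_over_def
    by (intro exI[of _ "\<lambda>x. p x * d x ^ l + q x * d x ^ m"] exI[of _ "m + l"] conjI
        real_polynomial_function.intros(3,4) real_polynomial_function_power d)
      (simp_all add: power_add algebra_simps flip: p(2) q(2))
qed

lemma rational_over_diff:
  assumes "real_polynomial_function d" "rational_over d f" "rational_over d g"
  shows "rational_over d (\<lambda>x. f x - g x)"
  using rational_over_add[OF assms(1,2) rational_over_mult[OF rational_over_const[of d "-1"] assms(3)]]
  by simp

lemma rational_over_sum:
  assumes "real_polynomial_function d" "\<And>i. i \<in> I \<Longrightarrow> rational_over d (f i)"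
  shows "rational_over d (\<lambda>x. \<Sum>i\<in>I. f i x)"
  using assms(2)
  by (induction I rule: infinite_finite_induct)
    (auto intro: rational_over_const rational_over_add[OF assms(1)])

lemma rational_over_prod:
  assumes "\<And>i. i \<in> I \<Longrightarrow> rational_over d (f i)"
  shows "rational_over d (\<lambda>x. \<Prod>i\<in>I. f i x)"
  using assms
  by (induction I rule: infinite_finite_induct)
    (auto intro: rational_over_const rational_over_mult)

lemma rational_over_det:
  assumes "real_polynomial_function d" "\<And>i j. rational_over d (\<lambda>x. A x $ i $ j)"
  shows "rational_over d (\<lambda>x. det (A x))"
  unfolding det_def
  by (intro rational_over_sum rational_over_prod rational_over_mult rational_over_const assms)

lemma rational_over_matrix_mult:
  assumes "real_polynomial_function d" "\<And>i j. rational_over d (\<lambda>x. A x $ i $ j)"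
    and "\<And>i j. rational_over d (\<lambda>x. B x $ i $ j)"
  shows "rational_over d (\<lambda>x. (A x ** B x) $ i $ j)"
  unfolding matrix_matrix_mult_def vec_lambda_beta
  by (intro rational_over_sum rational_over_mult assms)

lemma rational_over_matrix_vector_mult:
  assumes "real_polynomial_function d" "\<And>i j. rational_over d (\<lambda>x. A x $ i $ j)"
    and "\<And>j. rational_over d (\<lambda>x. v x $ j)"
  shows "rational_over d (\<lambda>x. (A x *v v x) $ i)"
  unfolding matrix_vector_mult_def vec_lambda_beta
  by (intro rational_over_sum rational_over_mult assms)

lemma real_polynomial_function_det:
  assumes "\<And>i j. real_polynomial_function (\<lambda>x. A x $ i $ j)"
  shows "real_polynomial_function (\<lambda>x. det (A x))"
  unfolding det_def
  by (intro real_polynomial_function_sum real_polynomial_function_prod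
      real_polynomial_function.intros(4) real_polynomial_function.intros(2) assms) simp_all

lemma matrix_inv_nonsingular:
  fixes A :: "('n::finite, 'n) rmat"
  assumes "det A \<noteq> 0"
  shows "A ** matrix_inv A = mat 1" "matrix_inv A ** A = mat 1"
proof -
  have "\<exists>B. A ** B = mat 1 \<and> B ** A = mat 1"
    using assms by (simp flip: invertible_det_nz add: invertible_def)
  then show "A ** matrix_inv A = mat 1" "matrix_inv A ** A = mat 1"
    unfolding matrix_inv_def by (rule someI2_ex, simp)+
qed

text \<open>By Cramer's rule an inverse has entries that are rational with the determinant as their
  denominator.\<close>
lemma rational_over_matrix_inv:
  fixes A :: "'a::real_normed_vector \<Rightarrow> ('n::finite, 'n) rmat"
  assumes A: "\<And>i j. real_polynomial_function (\<lambda>x. A x $ i $ j)"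
  shows "rational_over (\<lambda>x. det (A x)) (\<lambda>x. matrix_inv (A x) $ i $ j)"
proof -
  let ?M = "\<lambda>x. (\<chi> k l. if l = i then axis j 1 $ k else A x $ k $ l) :: ('n, 'n) rmat"
  have "matrix_inv (A x) $ i $ j * det (A x) ^ 1 = det (?M x)" if "det (A x) \<noteq> 0" for x
  proof -
    have "A x *v (matrix_inv (A x) *v axis j 1) = axis j 1"
      by (simp add: matrix_vector_mul_assoc matrix_inv_nonsingular[OF that])
    then have "(matrix_inv (A x) *v axis j 1) $ i = det (?M x) / det (A x)"
      unfolding cramer[OF that] by simp
    then show ?thesis
      using that by (simp add: matrix_vector_mult_basis column_def)
  qed
  moreover have "real_polynomial_function (\<lambda>x. det (?M x))"
  proof (rule real_polynomial_function_det)
    fix k l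
    show "real_polynomial_function (\<lambda>x. ?M x $ k $ l)"
      using A by (cases "l = i") (auto intro: real_polynomial_function.intros(2))
  qed
  ultimately show ?thesis
    unfolding rational_over_def by blast
qed

lemma negligible_rational_zeros:
  fixes f :: "'a::euclidean_space \<Rightarrow> real"
  assumes "rational_over d f" "d a \<noteq> 0" "f a \<noteq> 0"
  shows "negligible {x. d x \<noteq> 0 \<and> f x = 0}"
proof -
  obtain p m where p: "real_polynomial_function p" "\<And>x. d x \<noteq> 0 \<Longrightarrow> f x * d x ^ m = p x"
    using assms(1) unfolding rational_over_def by metis
  then have "p a \<noteq> 0"
    using assms(2,3) by (metis mult_eq_0_iff power_eq_0_iff)
  moreover have "{x. d x \<noteq> 0 \<and> f x = 0} \<subseteq> {x. p x = 0}"
    using p(2) by force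
  ultimately show ?thesis
    using negligible_polynomial_zeros[OF p(1)] negligible_subset by blast
qed

section \<open>Least squares with a design matrix of full column rank\<close>

lemma det_eq_0_iff_kernel:
  fixes A :: "('n::finite, 'n) rmat"
  shows "det A = 0 \<longleftrightarrow> (\<exists>v. v \<noteq> 0 \<and> A *v v = 0)"
  using rank_bound[of A] by (simp add: det_eq_0_rank matrix_nonfull_linear_equations_eq less_le)

lemma full_row_rank_iff:
  fixes A :: "('q::finite, 'n::finite) rmat"
  shows "rank A = CARD('q) \<longleftrightarrow> (\<forall>v. v v* A = 0 \<longrightarrow> v = 0)"
  using matrix_nonfull_linear_equations_eq[of "transpose A"] by (auto simp: rank_transpose)

lemma full_column_rank_iff:
  fixes X :: "('n::finite, 'k::finite) rmat"
  shows "rank X = CARD('k) \<longleftrightarrow> (\<forall>v. X *v v = 0 \<longrightarrow> v = 0)"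
  using matrix_nonfull_linear_equations_eq[of X] by auto

lemma det_gram_nonzero_iff:
  fixes X :: "('n::finite, 'k::finite) rmat"
  shows "det (transpose X ** X) \<noteq> 0 \<longleftrightarrow> rank X = CARD('k)"
proof -
  have "X *v v = 0" if "(X *v v) v* X = 0" for v
  proof -
    have "(X *v v) \<bullet> (X *v v) = ((X *v v) v* X) \<bullet> v"
      by (simp add: dot_lmul_matrix)
    with that show ?thesis by simp
  qed
  then show ?thesis
    unfolding det_eq_0_iff_kernel full_column_rank_iff
    by (auto simp flip: matrix_vector_mul_assoc)
qed

text \<open>Used for the explicit designs below, whose columns are orthogonal by construction.\<close>

lemma orthogonal_columns_full_rank:
  fixes X :: "('n::finite, 'k::finite) rmat"
  assumes "\<And>i j. i \<noteq> j \<Longrightarrow> column i X \<bullet> column j X = 0" and "\<And>j. column j X \<noteq> 0"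
  shows "rank X = CARD('k)"
  unfolding full_column_rank_iff
proof (intro allI impI)
  fix v assume v: "X *v v = 0"
  have "v $ i = 0" for i
  proof -
    have "0 = column i X \<bullet> (X *v v)"
      using v by simp
    also have "\<dots> = (\<Sum>j\<in>UNIV. v $ j * (column i X \<bullet> column j X))"
      by (simp add: matrix_mult_sum inner_sum_right scalar_mult_eq_scaleR)
    also have "\<dots> = (\<Sum>j\<in>UNIV. if j = i then v $ i * (column i X \<bullet> column i X) else 0)"
      by (intro sum.cong refl) (use assms(1) in auto)
    finally show ?thesis
      using assms(2)[of i] by simp
  qed
  then show "v = 0" by (simp add: vec_eq_iff)
qed

text \<open>The normal equations have only one solution.  Exhibiting a residual orthogonal to
  the columns of \<open>X\<close> therefore identifies the estimator without computing an inverse.\<close>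

lemma beta_hat_unique:
  fixes X :: "('n::finite, 'k::finite) rmat"
  assumes "rank X = CARD('k)" and "(y - X *v b) v* X = 0"
  shows "beta_hat X y = b"
proof -
  let ?G = "transpose X ** X"
  have "y v* X = ?G *v b"
    using assms(2) by (simp add: vector_matrix_mult_diff_rdistrib flip: matrix_vector_mul_assoc transpose_matrix_vector)
      (simp add: matrix_vector_mult_diff_distrib)
  then have "beta_hat X y = matrix_inv ?G *v (?G *v b)"
    by (simp add: beta_hat_def flip: matrix_vector_mul_assoc)
  then show ?thesis
    using assms(1) by (simp add: matrix_vector_mul_assoc matrix_inv_nonsingular det_gram_nonzero_iff)
qed

lemma u_hat_orthogonal:
  fixes X :: "('n::finite, 'k::finite) rmat"
  assumes "rank X = CARD('k)"
  shows "u_hat X y v* X = 0"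
proof -
  let ?G = "transpose X ** X"
  have "transpose X *v (X *v beta_hat X y) = (?G ** matrix_inv ?G) *v (transpose X *v y)"
    by (simp only: beta_hat_def matrix_vector_mul_assoc matrix_mul_assoc)
  then have "transpose X *v (X *v beta_hat X y) = transpose X *v y"
    using assms by (simp add: matrix_inv_nonsingular det_gram_nonzero_iff)
  then have "transpose X *v u_hat X y = 0"
    unfolding u_hat_def matrix_vector_mult_diff_distrib by simp
  then show ?thesis by simp
qed

lemma beta_hat_add_fitted:
  fixes X :: "('n::finite, 'k::finite) rmat"
  assumes "rank X = CARD('k)"
  shows "beta_hat X (y + X *v b) = beta_hat X y + b"
proof (rule beta_hat_unique[OF assms])
  have "y + X *v b - X *v (beta_hat X y + b) = u_hat X y"
    by (simp add: u_hat_def matrix_vector_right_distrib)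
  then show "(y + X *v b - X *v (beta_hat X y + b)) v* X = 0"
    by (simp add: u_hat_orthogonal[OF assms])
qed

lemma u_hat_add_fitted:
  fixes X :: "('n::finite, 'k::finite) rmat"
  assumes "rank X = CARD('k)"
  shows "u_hat X (y + X *v b) = u_hat X y"
  by (simp add: u_hat_def beta_hat_add_fitted[OF assms] matrix_vector_right_distrib)

lemma beta_hat_column:
  fixes X :: "('n::finite, 'k::finite) rmat"
  assumes "rank X = CARD('k)"
  shows "beta_hat X (column j X) = axis j 1"
  by (rule beta_hat_unique[OF assms]) (simp add: matrix_vector_mult_basis)

lemma transpose_matrix_inv_gram:
  fixes X :: "('n::finite, 'k::finite) rmat"
  assumes "rank X = CARD('k)"
  shows "transpose (matrix_inv (transpose X ** X)) = matrix_inv (transpose X ** X)"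
proof -
  let ?G = "transpose X ** X" and ?P = "matrix_inv (transpose X ** X)"
  have G: "?G ** ?P = mat 1" "?P ** ?G = mat 1"
    using assms by (simp_all add: matrix_inv_nonsingular det_gram_nonzero_iff)
  have "transpose ?P ** ?G = transpose (?G ** ?P)"
    by (simp add: matrix_transpose_mul transpose_transpose)
  then have "transpose ?P ** ?G = mat 1"
    using G by (simp add: transpose_mat)
  then have "(transpose ?P ** ?G) ** ?P = ?P" by simp
  then show ?thesis
    using G by (simp flip: matrix_mul_assoc)
qed

section \<open>The covariance estimator as a quadratic form\<close>

text \<open>The matrix whose positive definiteness is part of admissibility of the weights.\<close>

definition toeplitz :: "(int \<Rightarrow> real) \<Rightarrow> ('n::{finite,linorder}, 'n) rmat" where
  "toeplitz w = (\<chi> s t. w (int (pos s) - int (pos t)))"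

text \<open>Grouping all pairs \<open>(s, t)\<close> of time points by their lag \<open>s - t\<close>.  For negative lags the
  autocovariance is a transpose, which restores the order of the two factors, so the weight at
  lag \<open>j\<close> always meets a pair with \<open>s - t = j\<close>.\<close>

lemma sum_over_lags:
  fixes h :: "'n::{finite,linorder} \<Rightarrow> 'n \<Rightarrow> real"
  shows "(\<Sum>j = - (int CARD('n) - 1)..int CARD('n) - 1.
            w j * (if 0 \<le> j then (\<Sum>t = nat j + 1..CARD('n). h (idx t) (idx (t - nat j)))
                   else (\<Sum>t = nat (- j) + 1..CARD('n). h (idx (t - nat (- j))) (idx t))))
         = (\<Sum>s\<in>UNIV. \<Sum>t\<in>UNIV. w (int (pos s) - int (pos t)) * h s t)"
proof -
  let ?n = "CARD('n)"
  let ?S = "{1..?n} \<times> {1..?n}" and ?T = "{- (int ?n - 1)..int ?n - 1}"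
  let ?lag = "\<lambda>(s, t). int s - int t :: int"
  let ?h = "\<lambda>(s, t). w (int s - int t) * h (idx s) (idx t)"
  have reindex: "(\<Sum>s = 1..?n. f s) = (\<Sum>s::'n\<in>UNIV. f (pos s))" for f :: "nat \<Rightarrow> real"
    using sum.reindex_bij_betw[OF pos_bij[where 'a = 'n], of f] by simp
  \<comment> \<open>For a fixed lag one of the two time points determines the other.\<close>
  have "w j * (if 0 \<le> j then (\<Sum>t = nat j + 1..?n. h (idx t) (idx (t - nat j)))
               else (\<Sum>t = nat (- j) + 1..?n. h (idx (t - nat (- j))) (idx t)))
        = sum ?h {z. z \<in> ?S \<and> ?lag z = j}" for j
  proof (cases "0 \<le> j")
    case True
    have "(\<Sum>t = nat j + 1..?n. w j * h (idx t) (idx (t - nat j))) = sum ?h {z. z \<in> ?S \<and> ?lag z = j}"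
      using True by (intro sum.reindex_bij_witness[of _ fst "\<lambda>t. (t, t - nat j)"]) auto
    with True show ?thesis by (simp add: sum_distrib_left)
  next
    case False
    have "(\<Sum>t = nat (- j) + 1..?n. w j * h (idx (t - nat (- j))) (idx t))
          = sum ?h {z. z \<in> ?S \<and> ?lag z = j}"
      using False by (intro sum.reindex_bij_witness[of _ snd "\<lambda>t. (t - nat (- j), t)"]) auto
    with False show ?thesis by (simp add: sum_distrib_left)
  qed
  then have "(\<Sum>j\<in>?T. w j * (if 0 \<le> j then (\<Sum>t = nat j + 1..?n. h (idx t) (idx (t - nat j)))
                 else (\<Sum>t = nat (- j) + 1..?n. h (idx (t - nat (- j))) (idx t))))
             = (\<Sum>j\<in>?T. sum ?h {z. z \<in> ?S \<and> ?lag z = j})"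
    by simp
  also have "\<dots> = sum ?h ?S"
    by (rule sum.group) auto
  also have "\<dots> = (\<Sum>s = 1..?n. \<Sum>t = 1..?n. w (int s - int t) * h (idx s) (idx t))"
    by (simp add: sum.cartesian_product)
  also have "\<dots> = (\<Sum>s\<in>UNIV. \<Sum>t\<in>UNIV. w (int (pos s) - int (pos t)) * h s t)"
    by (simp only: reindex idx_pos)
  finally show ?thesis .
qed

lemma scaled_Psi_hat_nth:
  fixes X :: "('n::{finite,linorder}, 'k::finite) rmat"
  shows "real CARD('n) * Psi_hat w X y $ a $ b
    = (\<Sum>s\<in>UNIV. \<Sum>t\<in>UNIV. w (int (pos s) - int (pos t)) * (v_hat X y s $ a * v_hat X y t $ b))"
proof -
  have outer: "outer v u $ a $ b = v $ a * u $ b" for v u :: "'k rvec" and a b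
    by (simp add: outer_def matrix_matrix_mult_def columnvector_def rowvector_def)
  have "real CARD('n) * Gamma_hat X y j $ a $ b =
      (if 0 \<le> j
       then (\<Sum>t = nat j + 1..CARD('n). v_hat X y (idx t) $ a * v_hat X y (idx (t - nat j)) $ b)
       else (\<Sum>t = nat (- j) + 1..CARD('n). v_hat X y (idx (t - nat (- j))) $ a * v_hat X y (idx t) $ b))"
    for j
    by (simp add: Gamma_hat_def Gamma_hat_nonneg_def transpose_def outer mult.commute)
  moreover have "real CARD('n) * Psi_hat w X y $ a $ b
      = (\<Sum>j = - (int CARD('n) - 1)..int CARD('n) - 1. w j * (real CARD('n) * Gamma_hat X y j $ a $ b))"
    by (simp add: Psi_hat_def sum_distrib_left mult_ac)
  ultimately show ?thesis
    using sum_over_lags[of w "\<lambda>s t. v_hat X y s $ a * v_hat X y t $ b"] by simp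
qed

lemma scaled_Psi_hat_eq:
  fixes X :: "('n::{finite,linorder}, 'k::finite) rmat"
  shows "real CARD('n) *\<^sub>R Psi_hat w X y
    = transpose (diag_mat (u_hat X y) ** X) ** toeplitz w ** (diag_mat (u_hat X y) ** X)"
proof -
  define E where "E = diag_mat (u_hat X y) ** X"
  have E: "E $ t $ a = v_hat X y t $ a" for t a
    by (simp add: E_def diag_mat_def matrix_matrix_mult_def v_hat_def row_def
        if_distrib[of "\<lambda>z. z * _"] cong: if_cong)
  have "(transpose E ** toeplitz w ** E) $ a $ b
      = (\<Sum>t\<in>UNIV. \<Sum>s\<in>UNIV. w (int (pos s) - int (pos t)) * (v_hat X y s $ a * v_hat X y t $ b))"
    for a b
    by (simp add: matrix_matrix_mult_def transpose_def toeplitz_def E sum_distrib_left mult_ac)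
  then have "(transpose E ** toeplitz w ** E) $ a $ b = real CARD('n) * Psi_hat w X y $ a $ b" for a b
    unfolding scaled_Psi_hat_nth by (subst sum.swap) simp
  then show ?thesis
    by (simp add: vec_eq_iff E_def)
qed

text \<open>This form makes \<open>\<Omega>\<close> depend on the data only through \<open>B\<close>.  Since the weights are positive
  definite, \<open>\<Omega>\<close> is then singular exactly when the rows of \<open>B\<close> are dependent.\<close>

lemma Omega_hat_eq:
  fixes X :: "('n::{finite,linorder}, 'k::finite) rmat"
  assumes "rank X = CARD('k)"
  shows "Omega_hat w R X y = B_mat R X y ** toeplitz w ** transpose (B_mat R X y)"
proof -
  let ?P = "matrix_inv (transpose X ** X)" and ?D = "diag_mat (u_hat X y)"
  have D: "transpose ?D = ?D"
    by (simp add: transpose_def diag_mat_def vec_eq_iff)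
  have "Omega_hat w R X y = R ** ?P ** (real CARD('n) *\<^sub>R Psi_hat w X y) ** ?P ** transpose R"
    by (simp add: Omega_hat_def matrix_scalar_ac scalar_matrix_assoc)
  then show ?thesis
    unfolding B_mat_def scaled_Psi_hat_eq
    by (simp add: matrix_transpose_mul transpose_transpose D transpose_matrix_inv_gram[OF assms] matrix_mul_assoc)
qed

lemma Omega_hat_nonsingular_iff:
  fixes X :: "('n::{finite,linorder}, 'k::finite) rmat" and R :: "('q::finite, 'k) rmat"
  assumes "rank X = CARD('k)" and "admissible_weights TYPE('n) w"
  shows "det (Omega_hat w R X y) \<noteq> 0 \<longleftrightarrow> rank (B_mat R X y) = CARD('q)"
proof -
  let ?B = "B_mat R X y"
  have Omega: "Omega_hat w R X y *v v = ?B *v (toeplitz w *v (v v* ?B))" for v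
    unfolding Omega_hat_eq[OF assms(1)] by (simp flip: matrix_vector_mul_assoc)
  have "v v* ?B = 0" if "Omega_hat w R X y *v v = 0" for v
  proof -
    have "(v v* ?B) \<bullet> (toeplitz w *v (v v* ?B)) = v \<bullet> (Omega_hat w R X y *v v)"
      by (simp add: Omega dot_lmul_matrix)
    also have "\<dots> = 0" using that by simp
    finally show ?thesis
      using assms(2) unfolding admissible_weights_def pos_def_mat_def toeplitz_def
      by (metis less_irrefl)
  qed
  then show ?thesis
    unfolding full_row_rank_iff det_eq_0_iff_kernel by (auto simp: Omega)
qed

section \<open>The test statistic on the null space\<close>

text \<open>Adding \<open>X \<beta>\<close> with \<open>R \<beta> = r\<close> shifts the estimator by \<open>\<beta>\<close> and leaves the residuals unchanged,
  so the choice of \<open>\<mu>\<close> and the value of \<open>r\<close> cancel.\<close>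

lemma T_stat_add_M0:
  fixes X :: "('n::{finite,linorder}, 'k::finite) rmat"
  assumes "rank X = CARD('k)" and "\<mu> \<in> M0 X R r"
  shows "T_stat w R r X (y + \<mu>) =
    (if det (Omega_hat w R X y) \<noteq> 0
     then (R *v beta_hat X y) \<bullet> (matrix_inv (Omega_hat w R X y) *v (R *v beta_hat X y)) else 0)"
proof -
  obtain b where b: "\<mu> = X *v b" "R *v b = r"
    using assms(2) by (auto simp: M0_def)
  have "R *v beta_hat X (y + \<mu>) - r = R *v beta_hat X y"
    by (simp add: b(1) beta_hat_add_fitted[OF assms(1)] matrix_vector_right_distrib flip: b(2))
  moreover have "Omega_hat w R X (y + \<mu>) = Omega_hat w R X y"
    by (simp add: Omega_hat_eq[OF assms(1)] B_mat_def u_hat_add_fitted[OF assms(1)] b(1))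
  ultimately show ?thesis
    by (simp add: T_stat_def)
qed

lemma M0_nonempty:
  fixes R :: "('q::finite, 'k::finite) rmat"
  assumes "rank R = CARD('q)"
  shows "M0 X R r \<noteq> {}"
proof -
  obtain b where "R *v b = r"
    using assms by (metis full_rank_surjective surjD)
  then show ?thesis by (auto simp: M0_def)
qed

lemma T_stat_eq_for_all_M0_iff:
  fixes X :: "('n::{finite,linorder}, 'k::finite) rmat" and R :: "('q::finite, 'k) rmat"
  assumes "rank X = CARD('k)" and "rank R = CARD('q)"
  shows "(\<exists>\<mu> \<in> M0 X R r. T_stat w R r X (y + \<mu>) = C) \<longleftrightarrow>
    (\<forall>\<mu> \<in> M0 X R r. T_stat w R r X (y + \<mu>) = C)"
  using M0_nonempty[OF assms(2)] by (auto simp: T_stat_add_M0[OF assms(1)])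

lemma column_mult_diag_mat: "column i (A ** diag_mat u) = u $ i *\<^sub>R column i A"
  by (simp add: vec_eq_iff column_def matrix_matrix_mult_def diag_mat_def
      if_distrib[of "\<lambda>z. _ * z"] mult.commute cong: if_cong)

text \<open>If the \<open>i\<close>-th unit vector lies in the column space, the \<open>i\<close>-th residual vanishes, hence so does
  column \<open>i\<close> of \<open>B\<close>.  The other columns of \<open>B\<close> are multiples of the columns that survive the
  deletion, so these already span everything that the columns of \<open>B\<close> span.\<close>

lemma rank_condition_if_B_mat_full_rank:
  fixes X :: "('n::finite, 'k::finite) rmat" and R :: "('q::finite, 'k) rmat"
  assumes X: "rank X = CARD('k)" and B: "rank (B_mat R X y) = CARD('q)"
  shows "rank_condition X R"
proof -
  let ?A = "R ** matrix_inv (transpose X ** X) ** transpose X"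
  let ?I = "{i. axis i 1 \<in> span (columns X)}"
  let ?S = "{column i ?A | i. i \<notin> ?I}"
  have u: "u_hat X y $ i = 0" if i: "i \<in> ?I" for i
  proof -
    have "transpose X *v u_hat X y = 0"
      using u_hat_orthogonal[OF X] by simp
    moreover have "axis i 1 \<in> span (rows (transpose X))"
      using i by (simp add: rows_transpose)
    ultimately have "orthogonal (u_hat X y) (axis i 1)"
      by (rule orthogonal_nullspace_rowspace)
    then show ?thesis
      by (simp add: orthogonal_def inner_axis)
  qed
  have col: "column i (B_mat R X y) = u_hat X y $ i *\<^sub>R column i ?A" for i
    by (simp add: B_mat_def column_mult_diag_mat)
  have "column i (B_mat R X y) \<in> span ?S" for i
  proof (cases "i \<in> ?I")
    case True
    then show ?thesis by (simp add: col u span_zero)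
  next
    case False
    then show ?thesis unfolding col by (intro span_scale span_base) blast
  qed
  then have "columns (B_mat R X y) \<subseteq> span ?S"
    unfolding columns_def[of "B_mat R X y"] by blast
  then have "dim (columns (B_mat R X y)) \<le> dim ?S"
    using dim_subset[of "columns (B_mat R X y)" "span ?S"] by (simp only: dim_span)
  moreover have "dim ?S \<le> CARD('q)"
    using dim_subset_UNIV[of ?S] by simp
  ultimately show ?thesis
    using B unfolding rank_condition_def rank_del_columns_def column_rank_def by simp
qed

text \<open>When \<open>B\<close> has full rank the rank condition holds automatically, so only the equality of the
  statistic with \<open>C\<close> can keep the design from being covered.\<close>

lemma not_covered_imp_exceptional:
  fixes X :: "('n::{finite,linorder}, 'k::finite) rmat" and R :: "('q::finite, 'k) rmat"
  assumes X: "rank X = CARD('k)" and R: "rank R = CARD('q)"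
    and "\<not> covered w R r C X" and e: "e \<in> {e_plus, e_minus}"
  shows "rank (B_mat R X e) < CARD('q) \<or> (\<exists>\<mu> \<in> M0 X R r. T_stat w R r X (e + \<mu>) = C)"
proof (rule disjCI)
  assume "\<not> (\<exists>\<mu> \<in> M0 X R r. T_stat w R r X (e + \<mu>) = C)"
  then have "\<exists>\<mu> \<in> M0 X R r. T_stat w R r X (e + \<mu>) > C \<or> T_stat w R r X (e + \<mu>) < C"
    using M0_nonempty[OF R] by (meson all_not_in_conv linorder_less_linear)
  then have "rank (B_mat R X e) \<noteq> CARD('q)"
    using rank_condition_if_B_mat_full_rank[OF X] X e \<open>\<not> covered w R r C X\<close>
    unfolding covered_def by blast
  moreover have "rank (B_mat R X e) \<le> CARD('q)"
    using rank_bound[of "B_mat R X e"] by simp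
  ultimately show "rank (B_mat R X e) < CARD('q)" by simp
qed

section \<open>Null sets of exceptional designs\<close>

lemma rank_less_iff: 
  fixes A :: "('q::finite, 'n::finite) rmat"
  shows "rank A < CARD('q) \<longleftrightarrow> rank A \<noteq> CARD('q)"
  using rank_bound[of A] by auto

text \<open>One rational function serves both exceptional sets: the choice \<open>c = 0\<close> gives \<open>det \<Omega>\<close>, whose
  zeros are the rank-deficient designs, and \<open>c = 1 / C\<close> captures the level set of the statistic.\<close>

lemma rational_over_bordered_Omega:
  fixes F :: "'a::euclidean_space \<Rightarrow> ('n::{finite,linorder}, 'k::finite) rmat"
    and R :: "('q::finite, 'k) rmat" and e :: "'n rvec"
  assumes F: "\<And>i j. real_polynomial_function (\<lambda>x. F x $ i $ j)"
  defines "d \<equiv> \<lambda>x. det (transpose (F x) ** F x)"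
  defines "B \<equiv> \<lambda>x. B_mat R (F x) e"
  shows "rational_over d (\<lambda>x. det (B x ** toeplitz w ** transpose (B x)
      - (\<chi> i j. c * ((R *v beta_hat (F x) e) $ i * (R *v beta_hat (F x) e) $ j))))"
proof -
  have gram: "real_polynomial_function (\<lambda>x. (transpose (F x) ** F x) $ i $ j)" for i j
    unfolding matrix_matrix_mult_def transpose_def vec_lambda_beta
    by (intro real_polynomial_function_sum real_polynomial_function.intros(4) F) simp
  then have d: "real_polynomial_function d"
    unfolding d_def by (rule real_polynomial_function_det)
  note rational = rational_over_const rational_over_mult rational_over_diff[OF d]
    rational_over_matrix_mult[OF d] rational_over_matrix_vector_mult[OF d]
  have rF: "rational_over d (\<lambda>x. F x $ i $ j)" for i j
    by (rule rational_over_polynomial[OF F])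
  have rFt: "rational_over d (\<lambda>x. transpose (F x) $ i $ j)" for i j
    unfolding transpose_def by (simp add: rF)
  have P: "rational_over d (\<lambda>x. matrix_inv (transpose (F x) ** F x) $ i $ j)" for i j
    unfolding d_def by (rule rational_over_matrix_inv[OF gram])
  have beta: "rational_over d (\<lambda>x. beta_hat (F x) e $ j)" for j
    unfolding beta_hat_def by (intro rational P rFt)
  have z: "rational_over d (\<lambda>x. (R *v beta_hat (F x) e) $ i)" for i
    by (intro rational beta)
  have u: "rational_over d (\<lambda>x. u_hat (F x) e $ t)" for t
    unfolding u_hat_def vector_minus_component by (intro rational beta rF)
  have "rational_over d (\<lambda>x. diag_mat (u_hat (F x) e) $ i $ j)" for i j
    unfolding diag_mat_def by (cases "i = j") (simp_all add: u rational_over_const)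
  then have B: "rational_over d (\<lambda>x. B x $ i $ j)" for i j
    unfolding B_def B_mat_def by (intro rational P rFt)
  have Bt: "rational_over d (\<lambda>x. transpose (B x) $ i $ j)" for i j
    unfolding transpose_def by (simp add: B)
  show ?thesis
    by (intro rational_over_det[OF d], unfold vector_minus_component vec_lambda_beta)
      (intro rational B Bt z)
qed

text \<open>If \<open>z' A\<^sup>-\<^sup>1 z = C\<close>, the nonzero vector \<open>A\<^sup>-\<^sup>1 z\<close> lies in the kernel of \<open>A - z z' / C\<close>.  This turns the equation
  \<open>T = C\<close> into the vanishing of a determinant, without inverting \<open>\<Omega>\<close>.\<close>

lemma det_bordered_eq_0:
  fixes A :: "('q::finite, 'q) rmat"
  assumes "det A \<noteq> 0" and C: "z \<bullet> (matrix_inv A *v z) = C" and "C \<noteq> 0"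
  shows "det (A - (\<chi> i j. inverse C * (z $ i * z $ j))) = 0"
proof -
  let ?v = "matrix_inv A *v z"
  have "?v \<noteq> 0" using C \<open>C \<noteq> 0\<close> by auto
  have "(\<chi> i j. inverse C * (z $ i * z $ j)) *v ?v = (inverse C * (z \<bullet> ?v)) *\<^sub>R z"
    by (simp add: vec_eq_iff matrix_vector_mult_def[of "\<chi> i j. _ i j"] inner_vec_def sum_distrib_left mult_ac)
  then have "(\<chi> i j. inverse C * (z $ i * z $ j)) *v ?v = z"
    using \<open>C \<noteq> 0\<close> by (simp only: C) simp
  moreover have "A *v ?v = z"
    by (simp add: matrix_vector_mul_assoc matrix_inv_nonsingular[OF assms(1)])
  ultimately have "(A - (\<chi> i j. inverse C * (z $ i * z $ j))) *v ?v = 0"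
    by (simp only: matrix_vector_mult_diff_rdistrib) simp
  with \<open>?v \<noteq> 0\<close> show ?thesis
    unfolding det_eq_0_iff_kernel by blast
qed

text \<open>Without zero residuals the diagonal factor of \<open>B\<close> is invertible, and the remaining factor
  \<open>R (X' X)\<^sup>-\<^sup>1 X'\<close> inherits full row rank from \<open>R\<close> and \<open>X\<close>.\<close>

lemma B_mat_full_rank_if_residuals_nonzero:
  fixes X :: "('n::finite, 'k::finite) rmat" and R :: "('q::finite, 'k) rmat"
  assumes X: "rank X = CARD('k)" and R: "rank R = CARD('q)"
    and u: "\<And>t. u_hat X y $ t \<noteq> 0"
  shows "rank (B_mat R X y) = CARD('q)"
  unfolding full_row_rank_iff
proof (intro allI impI)
  fix v
  let ?P = "matrix_inv (transpose X ** X)"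
  assume "v v* B_mat R X y = 0"
  moreover have "v v* B_mat R X y = X *v ((v v* R) v* ?P) v* diag_mat (u_hat X y)"
    by (simp add: B_mat_def flip: vector_matrix_mul_assoc)
  moreover have "(a v* diag_mat b) $ t = a $ t * b $ t" for a b :: "'n rvec" and t
    by (simp add: vector_matrix_mult_def diag_mat_def if_distrib[of "\<lambda>z. _ * z"] mult.commute cong: if_cong)
  ultimately have "X *v ((v v* R) v* ?P) = 0"
    using u by (simp add: vec_eq_iff)
  then have "(v v* R) v* ?P = 0"
    using X by (simp add: full_column_rank_iff)
  then have "(v v* R) v* (?P ** (transpose X ** X)) = 0"
    by (metis vector_matrix_mul_assoc vector_matrix_mult_0)
  then have "v v* R = 0"
    using X by (simp add: matrix_inv_nonsingular det_gram_nonzero_iff)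
  then show "v = 0"
    using R by (simp add: full_row_rank_iff)
qed

text \<open>The map \<open>F\<close> parametrises the admitted designs, with or without a prescribed column.  A single
  parameter \<open>a\<close> settles all three claims: there \<open>z = R \<beta>\<close> vanishes for the least squares
  coefficient \<open>\<beta>\<close> of \<open>e\<close>, so \<open>det (\<Omega> - c z z') = det \<Omega> \<noteq> 0\<close> for every \<open>c\<close>, and a
  rational function that is nonzero at one point vanishes only on a null set.\<close>

lemma negligible_exceptional_designs:
  fixes F :: "'a::euclidean_space \<Rightarrow> ('n::{finite,linorder}, 'k::finite) rmat"
    and R :: "('q::finite, 'k) rmat"
  assumes F: "\<And>i j. real_polynomial_function (\<lambda>x. F x $ i $ j)"
    and R: "rank R = CARD('q)" and "0 < C" and w: "admissible_weights TYPE('n) w"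
    and a: "rank (F a) = CARD('k)" "R *v beta_hat (F a) e = 0" "\<And>t. u_hat (F a) e $ t \<noteq> 0"
  shows "negligible {x. rank (F x) \<noteq> CARD('k)}"
    and "negligible {x. rank (F x) = CARD('k) \<and> rank (B_mat R (F x) e) < CARD('q)}"
    and "negligible {x. rank (F x) = CARD('k) \<and> rank (B_mat R (F x) e) = CARD('q) \<and>
           (\<exists>\<mu> \<in> M0 (F x) R r. T_stat w R r (F x) (e + \<mu>) = C)}" (is "negligible ?T")
proof -
  let ?d = "\<lambda>x. det (transpose (F x) ** F x)"
  let ?z = "\<lambda>x. R *v beta_hat (F x) e"
  let ?A = "\<lambda>c x. B_mat R (F x) e ** toeplitz w ** transpose (B_mat R (F x) e)
      - (\<chi> i j. c * (?z x $ i * ?z x $ j))"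
  have zero: "(\<chi> i j. 0) = (0 :: ('q, 'q) rmat)"
    by (simp add: vec_eq_iff)
  have Omega: "?A 0 x = Omega_hat w R (F x) e" if "rank (F x) = CARD('k)" for x
    by (simp add: Omega_hat_eq[OF that] zero)
  have "det (Omega_hat w R (F a) e) \<noteq> 0"
    using Omega_hat_nonsingular_iff[OF a(1) w, of R e] B_mat_full_rank_if_residuals_nonzero[OF a(1) R a(3)] by simp
  then have "det (?A c a) \<noteq> 0" for c
    by (simp add: a(2) zero flip: Omega_hat_eq[OF a(1)])
  then have null: "negligible {x. ?d x \<noteq> 0 \<and> det (?A c x) = 0}" for c
    using a(1) by (intro negligible_rational_zeros[OF rational_over_bordered_Omega[OF F], of a])
      (simp_all add: det_gram_nonzero_iff)
  show "negligible {x. rank (F x) = CARD('k) \<and> rank (B_mat R (F x) e) < CARD('q)}"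
  proof (rule negligible_subset[OF null[of 0]], clarify)
    fix x assume x: "rank (F x) = CARD('k)" "rank (B_mat R (F x) e) < CARD('q)"
    then have "det (Omega_hat w R (F x) e) = 0"
      using Omega_hat_nonsingular_iff[OF x(1) w, of R e] by auto
    then show "?d x \<noteq> 0 \<and> det (?A 0 x) = 0"
      using x(1) unfolding Omega[OF x(1)] by (simp add: det_gram_nonzero_iff)
  qed
  show "negligible ?T"
  proof (rule negligible_subset[OF null[of "inverse C"]], clarify)
    fix x \<mu> assume x: "rank (F x) = CARD('k)" "rank (B_mat R (F x) e) = CARD('q)"
      and \<mu>: "\<mu> \<in> M0 (F x) R r" and T: "C = T_stat w R r (F x) (e + \<mu>)"
    have det: "det (Omega_hat w R (F x) e) \<noteq> 0"
      using Omega_hat_nonsingular_iff[OF x(1) w, of R e] x(2) by simp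
    then have "det (Omega_hat w R (F x) e - (\<chi> i j. inverse C * (?z x $ i * ?z x $ j))) = 0"
      using T_stat_add_M0[OF x(1) \<mu>] T \<open>0 < C\<close> by (intro det_bordered_eq_0) simp_all
    then show "?d x \<noteq> 0 \<and> det (?A (inverse (T_stat w R r (F x) (e + \<mu>))) x) = 0"
      using x(1) unfolding T Omega_hat_eq[OF x(1)] by (simp add: det_gram_nonzero_iff)
  qed
  have "real_polynomial_function ?d"
    unfolding matrix_matrix_mult_def transpose_def
    by (intro real_polynomial_function_det)
      (auto intro!: real_polynomial_function_sum real_polynomial_function.intros(4) F)
  moreover have "{x. rank (F x) \<noteq> CARD('k)} = {x. ?d x = 0}"
    by (auto simp flip: det_gram_nonzero_iff)
  ultimately show "negligible {x. rank (F x) \<noteq> CARD('k)}"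
    using a(1) negligible_polynomial_zeros[of ?d a] by (simp add: det_gram_nonzero_iff)
qed

section \<open>Nonexceptional designs\<close>

lemma orthonormal_family_orthogonal_to:
  fixes A :: "'n::finite rvec set"
  assumes "finite A" and "card A + CARD('m) \<le> CARD('n)"
  obtains f :: "'m::finite \<Rightarrow> 'n rvec"
  where "\<And>i j. f i \<bullet> f j = (if i = j then 1 else 0)" and "\<And>i a. a \<in> A \<Longrightarrow> a \<bullet> f i = 0"
proof -
  let ?S = "{y \<in> UNIV. \<forall>x \<in> span A. orthogonal x y}"
  have "subspace ?S"
    by (auto simp: subspace_def orthogonal_clauses)
  then obtain B where B: "B \<subseteq> ?S" "pairwise orthogonal B" "\<And>x. x \<in> B \<Longrightarrow> norm x = 1"
    "independent B" "card B = dim ?S"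
    by (rule orthonormal_basis_subspace) blast
  have "dim ?S + dim (span A) = CARD('n)"
    using dim_subspace_orthogonal_to_vectors[of "span A" "UNIV :: 'n rvec set"] by simp
  moreover have "dim (span A) \<le> card A"
    using dim_le_card'[OF assms(1)] by simp
  ultimately have "card (UNIV :: 'm set) \<le> card B"
    using assms(2) B(5) by simp
  then obtain f :: "'m \<Rightarrow> 'n rvec" where f: "inj f" "range f \<subseteq> B"
    using card_le_inj[of "UNIV :: 'm set" B] B(4) independent_imp_finite by auto
  show ?thesis
  proof
    show "f i \<bullet> f j = (if i = j then 1 else 0)" for i j
    proof -
      have "f i \<in> B" "f j \<in> B" using f by auto
      then show ?thesis
        using B(2,3) f(1) by (auto simp: pairwise_def orthogonal_def inj_eq dot_square_norm)
    qed
    show "a \<bullet> f i = 0" if "a \<in> A" for i a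
      using that f(2) B(1) span_base[of a A] by (auto simp: orthogonal_def)
  qed
qed

lemma e_plus_nth [simp]: "e_plus $ t = 1"
  by (simp add: e_plus_def)

lemma e_minus_nth [simp]: "e_minus $ t = (-1) ^ pos t"
  by (simp add: e_minus_def)

text \<open>Regressing \<open>e\<close> on columns orthogonal to it leaves \<open>e\<close> itself as the residual; there is room for
  \<open>k\<close> such columns because \<open>k < n\<close>.\<close>

lemma orthonormal_design:
  fixes e :: "'n::finite rvec"
  assumes "CARD('k) < CARD('n)"
  obtains X :: "('n, 'k::finite) rmat"
  where "rank X = CARD('k)" "beta_hat X e = 0" "u_hat X e = e"
proof -
  have "card {e} + CARD('k) \<le> CARD('n)"
    using assms by simp
  then obtain f :: "'k \<Rightarrow> 'n rvec"
    where f: "\<And>i j. f i \<bullet> f j = (if i = j then 1 else 0)" "\<And>i. e \<bullet> f i = 0"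
    by (rule orthonormal_family_orthogonal_to[rotated]) auto
  define X :: "('n, 'k) rmat" where "X = (\<chi> t j. f j $ t)"
  have col: "column j X = f j" for j
    by (simp add: X_def column_def vec_eq_iff)
  have "f j \<noteq> 0" for j
    using f(1)[of j j] by force
  then have X: "rank X = CARD('k)"
    by (intro orthogonal_columns_full_rank) (simp_all add: col f(1))
  have b: "beta_hat X e = 0"
    by (rule beta_hat_unique[OF X])
      (use f(2) in \<open>simp add: vec_eq_iff vector_matrix_mult_def X_def inner_vec_def mult.commute\<close>)
  then have "u_hat X e = e"
    unfolding u_hat_def by (subst b) simp
  with X b show ?thesis by (rule that)
qed

lemma pos_ge_1: "1 \<le> pos i" and pos_le_card: "pos (i :: 'a::{finite,linorder}) \<le> CARD('a)"
  using pos_bij[where 'a = 'a] by (auto simp: bij_betw_def)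

lemma with_ones_column_1:
  "column (idx 1) (with_ones Xt :: ('n::finite, 'k::{finite,linorder}) rmat) = e_plus"
  using pos_idx[of 1, where 'a = 'k]
  by (simp add: vec_eq_iff column_def with_ones_def Suc_leI card_gt_0_iff)

lemma beta_hat_with_ones_e_plus:
  fixes Xt :: "('n::finite, 'm::{finite,linorder}) rmat"
  assumes "rank (with_ones Xt :: ('n, 'k::{finite,linorder}) rmat) = CARD('k)"
  shows "beta_hat (with_ones Xt :: ('n, 'k) rmat) e_plus = axis (idx 1) 1"
  using beta_hat_column[OF assms, of "idx 1"] by (simp only: with_ones_column_1)

lemma B_mat_with_ones_e_plus:
  fixes Xt :: "('n::finite, 'm::{finite,linorder}) rmat" and R :: "('q::finite, 'k::{finite,linorder}) rmat"
  assumes "rank (with_ones Xt :: ('n, 'k::{finite,linorder}) rmat) = CARD('k)"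
  shows "B_mat R (with_ones Xt) e_plus = 0"
proof -
  have "u_hat (with_ones Xt :: ('n, 'k) rmat) e_plus = 0"
    unfolding u_hat_def beta_hat_with_ones_e_plus[OF assms] matrix_vector_mult_basis with_ones_column_1
    by simp
  then have "diag_mat (u_hat (with_ones Xt :: ('n, 'k) rmat) e_plus) = 0"
    by (simp add: diag_mat_def vec_eq_iff)
  then show ?thesis
    unfolding B_mat_def by (simp add: matrix_matrix_mult_def vec_eq_iff)
qed

text \<open>A mean of signs that include both signs lies strictly between \<open>-1\<close> and \<open>1\<close>.\<close>

lemma demeaned_alternating_nonzero:
  assumes "2 \<le> CARD('n::{finite,linorder})" and c: "c * real CARD('n) = e_plus \<bullet> (e_minus :: 'n rvec)"
  shows "(e_minus :: 'n rvec) $ t \<noteq> c"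
proof
  assume t: "(e_minus :: 'n rvec) $ t = c"
  then have "c * c = 1"
    by (auto simp flip: power_add mult_2 simp: power_mult)
  \<comment> \<open>If the mean \<open>c\<close> were itself a sign, these nonnegative terms would sum to zero, and all signs would agree.\<close>
  have sgn: "0 \<le> 1 - c * e_minus $ i" for i :: 'n
    using t by (auto simp: minus_one_power_iff split: if_splits)
  have "(\<Sum>i\<in>UNIV. 1 - c * (e_minus :: 'n rvec) $ i) = real CARD('n) - c * (e_plus \<bullet> (e_minus :: 'n rvec))"
    by (simp add: sum_subtractf sum_distrib_left inner_vec_def)
  also have "\<dots> = 0"
    using \<open>c * c = 1\<close> by (simp flip: c)
  finally have "1 - c * (e_minus :: 'n rvec) $ i = 0" for i
    using sum_nonneg_eq_0_iff[of UNIV "\<lambda>i. 1 - c * (e_minus :: 'n rvec) $ i"] sgn by simp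
  from this[of "idx 1"] this[of "idx 2"] show False
    using assms(1) by (simp add: pos_idx)
qed

text \<open>With the remaining columns orthogonal to both \<open>e_plus\<close> and \<open>e_minus\<close>, regressing \<open>e_minus\<close>
  only removes its mean: the coefficient is carried by the intercept, which \<open>R\<close> annihilates when its
  first column is zero, and no residual vanishes.  The orthogonal complement has dimension at least
  \<open>n - 2\<close>, which leaves room for the \<open>k - 1\<close> columns.\<close>

lemma orthonormal_design_with_ones:
  assumes "CARD('k) < CARD('n)" "2 \<le> CARD('k)" "CARD('m) = CARD('k) - 1"
  obtains Xt :: "('n::{finite,linorder}, 'm::{finite,linorder}) rmat" and c
  where "rank (with_ones Xt :: ('n, 'k::{finite,linorder}) rmat) = CARD('k)"
    and "beta_hat (with_ones Xt :: ('n, 'k) rmat) e_minus = c *\<^sub>R axis (idx 1) 1"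
    and "\<And>t. u_hat (with_ones Xt :: ('n, 'k) rmat) e_minus $ t \<noteq> 0"
proof -
  have "card {e_plus, e_minus :: 'n rvec} \<le> 2"
    by (simp add: card_insert_if)
  then have "card {e_plus, e_minus :: 'n rvec} + CARD('m) \<le> CARD('n)"
    using assms by linarith
  then obtain f :: "'m \<Rightarrow> 'n rvec"
    where f: "\<And>i j. f i \<bullet> f j = (if i = j then 1 else 0)" "\<And>i. e_plus \<bullet> f i = 0" "\<And>i. e_minus \<bullet> f i = 0"
    by (rule orthonormal_family_orthogonal_to[rotated]) (blast, simp)
  define Xt :: "('n, 'm) rmat" where "Xt = (\<chi> t j. f j $ t)"
  let ?X = "with_ones Xt :: ('n, 'k) rmat"
  have col: "column j ?X = (if pos j = 1 then e_plus else f (idx (pos j - 1)))" for j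
    by (simp add: Xt_def column_def vec_eq_iff with_ones_def)
  have inj: "i = j" if "(idx (pos i - 1) :: 'm) = idx (pos j - 1)" "pos i \<noteq> 1" "pos j \<noteq> 1" for i j :: 'k
  proof -
    have *: "pos (idx (pos i - 1) :: 'm) = pos i - 1" "pos (idx (pos j - 1) :: 'm) = pos j - 1"
      using that(2,3) pos_ge_1[of i] pos_ge_1[of j] pos_le_card[of i] pos_le_card[of j] assms(3)
      by (auto intro!: pos_idx)
    have "pos i - 1 = pos j - 1"
      using *[unfolded that(1)] by (rule trans[OF sym])
    then have "pos i = pos j"
      using pos_ge_1[of i] pos_ge_1[of j] by linarith
    then show ?thesis
      by (simp add: inj_eq[OF pos_inj])
  qed
  have nz: "e_plus \<noteq> (0 :: 'n rvec)" "f i \<noteq> 0" for i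
    using f(1)[of i i] by (simp add: vec_eq_iff, force)
  have X: "rank ?X = CARD('k)"
  proof (rule orthogonal_columns_full_rank)
    fix i j :: 'k assume "i \<noteq> j"
    then show "column i ?X \<bullet> column j ?X = 0"
      using inj[of i j] inj_eq[OF pos_inj, of i j] f(1) f(2)
      by (auto simp: col inner_commute)
  qed (simp add: col nz)
  define c where "c = (e_plus \<bullet> (e_minus :: 'n rvec)) / real CARD('n)"
  have fit: "?X *v (c *\<^sub>R axis (idx 1) 1) = c *\<^sub>R e_plus"
    by (simp only: matrix_vector_mult_scaleR matrix_vector_mult_basis with_ones_column_1)
  have one: "e_plus \<bullet> (e_plus :: 'n rvec) = real CARD('n)"
    by (simp add: inner_vec_def)
  have "(e_minus - c *\<^sub>R e_plus) \<bullet> column j ?X = 0" for j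
    using f(2,3) by (simp add: col inner_diff_left one) (simp add: c_def inner_commute)
  then have "((e_minus - c *\<^sub>R e_plus) v* ?X) $ j = 0" for j
    by (simp add: vector_matrix_mult_def inner_vec_def column_def mult.commute)
  then have b: "beta_hat ?X e_minus = c *\<^sub>R axis (idx 1) 1"
    by (intro beta_hat_unique[OF X]) (unfold fit, simp add: vec_eq_iff)
  have "u_hat ?X e_minus $ t \<noteq> 0" for t
    using demeaned_alternating_nonzero[where 'n = 'n, of c t] assms
    unfolding u_hat_def b fit by (simp add: c_def)
  with X b show ?thesis by (rule that)
qed

section \<open>The exceptional sets and coverage\<close>

lemma real_polynomial_function_entry:
  "real_polynomial_function (\<lambda>X :: ('n::finite, 'k::finite) rmat. X $ i $ j)"
  by (intro real_polynomial_function.intros(1) bounded_linear_compose[OF bounded_linear_vec_nth bounded_linear_vec_nth])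

lemma real_polynomial_function_with_ones:
  "real_polynomial_function (\<lambda>Xt :: ('n::finite, 'm::{finite,linorder}) rmat.
     (with_ones Xt :: ('n, 'k::{finite,linorder}) rmat) $ i $ j)"
  by (cases "pos j = 1")
    (simp_all add: with_ones_def real_polynomial_function_entry real_polynomial_function.intros(2))

lemma exceptional_designs:
  fixes R :: "('q::finite, 'k::{finite,linorder}) rmat"
    and r :: "'q rvec" and C :: real and w :: "int \<Rightarrow> real"
  assumes "CARD('k) < CARD('n::{finite,linorder})" and R: "rank R = CARD('q)" and "0 < C"
    and w: "admissible_weights TYPE('n) w"
  shows "(\<forall>e \<in> {e_plus, e_minus :: 'n rvec}.
         XX2 w R r C e
           = {X \<in> XX0 - XX1 R e. \<forall>\<mu> \<in> M0 X R r. T_stat w R r X (e + \<mu>) = C} \<and>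
         XX1 R e \<in> null_sets lebesgue \<and>
         XX2 w R r C e \<in> null_sets lebesgue) \<and>
      {X \<in> XX0. \<not> covered w R r C X}
        \<subseteq> (XX1 R (e_plus :: 'n rvec) \<union> XX2 w R r C e_plus) \<inter> (XX1 R e_minus \<union> XX2 w R r C e_minus) \<and>
      {X \<in> (XX0 :: ('n, 'k) rmat set). \<not> covered w R r C X} \<in> null_sets lebesgue \<and>
      - (XX0 :: ('n, 'k) rmat set) \<in> null_sets lebesgue"
proof -
  have indep: "XX2 w R r C e = {X \<in> XX0 - XX1 R e. \<forall>\<mu> \<in> M0 X R r. T_stat w R r X (e + \<mu>) = C}"
    for e :: "'n rvec"
    unfolding XX2_def
    by (intro Collect_cong conj_cong refl T_stat_eq_for_all_M0_iff[OF _ R]) (auto simp: XX0_def)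
  have null: "XX1 R e \<in> null_sets lebesgue" "XX2 w R r C e \<in> null_sets lebesgue"
    "- (XX0 :: ('n, 'k) rmat set) \<in> null_sets lebesgue"
    if "e \<in> {e_plus, e_minus}" for e :: "'n rvec"
  proof -
    obtain X :: "('n, 'k) rmat" where X: "rank X = CARD('k)" "beta_hat X e = 0" "u_hat X e = e"
      using orthonormal_design assms(1) by blast
    have e: "u_hat X e $ t \<noteq> 0" for t
      using that X(3) by auto
    have "R *v beta_hat X e = 0"
      using X by simp
    note neg = negligible_exceptional_designs[where F = "\<lambda>X. X",
        OF real_polynomial_function_entry R \<open>0 < C\<close> w X(1) this e]
    show "XX1 R e \<in> null_sets lebesgue"
      unfolding negligible_iff_null_sets[symmetric]
      by (rule negligible_subset[OF neg(2)]) (auto simp: XX0_def XX1_def)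
    show "XX2 w R r C e \<in> null_sets lebesgue"
      unfolding negligible_iff_null_sets[symmetric]
      by (rule negligible_subset[OF neg(3)[of r]]) (auto simp: XX0_def XX1_def XX2_def rank_less_iff)
    show "- (XX0 :: ('n, 'k) rmat set) \<in> null_sets lebesgue"
      unfolding negligible_iff_null_sets[symmetric]
      by (rule negligible_subset[OF neg(1)]) (auto simp: XX0_def)
  qed
  have sub: "{X \<in> XX0. \<not> covered w R r C X} \<subseteq> XX1 R e \<union> XX2 w R r C e"
    if "e \<in> {e_plus, e_minus}" for e :: "'n rvec"
    using not_covered_imp_exceptional[OF _ R _ that]
    unfolding XX0_def XX1_def XX2_def by blast
  have "negligible (XX1 R e_plus \<union> XX2 w R r C (e_plus :: 'n rvec))"
    using null[of e_plus] by (simp add: negligible_iff_null_sets null_sets.Un)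
  then have cov: "{X \<in> (XX0 :: ('n, 'k) rmat set). \<not> covered w R r C X} \<in> null_sets lebesgue"
    using negligible_subset[OF _ sub[of e_plus]] by (simp add: negligible_iff_null_sets)
  have null0: "- (XX0 :: ('n, 'k) rmat set) \<in> null_sets lebesgue"
    using null(3)[of e_plus] by simp
  show ?thesis
    by (intro conjI ballI; (rule indep null0 cov | rule null(1,2), assumption | (rule Int_greatest; rule sub; simp)))
qed

lemma exceptional_designs_with_ones:
  fixes R :: "('q::finite, 'k::{finite,linorder}) rmat"
    and r :: "'q rvec" and C :: real and w :: "int \<Rightarrow> real"
  assumes "CARD('k) < CARD('n::{finite,linorder})" and R: "rank R = CARD('q)" and "0 < C"
    and w: "admissible_weights TYPE('n) w"
    and k: "2 \<le> CARD('k)" "CARD('m::{finite,linorder}) = CARD('k) - 1" and R1: "column (idx 1) R = 0"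
  shows "(\<forall>e \<in> {e_plus, e_minus :: 'n rvec}.
         (XXt2 w R r C e :: ('n, 'm) rmat set)
           = {Xt \<in> XXt0 TYPE('k) - XXt1 R e.
                \<forall>\<mu> \<in> M0 (with_ones Xt) R r. T_stat w R r (with_ones Xt) (e + \<mu>) = C}) \<and>
      (XXt1 R e_minus :: ('n, 'm) rmat set) \<in> null_sets lebesgue \<and>
      (XXt2 w R r C e_minus :: ('n, 'm) rmat set) \<in> null_sets lebesgue \<and>
      (XXt1 R e_plus :: ('n, 'm) rmat set) = XXt0 TYPE('k) \<and>
      (XXt2 w R r C e_plus :: ('n, 'm) rmat set) = {} \<and>
      {Xt \<in> (XXt0 TYPE('k) :: ('n, 'm) rmat set). \<not> covered w R r C (with_ones Xt)}
        \<subseteq> XXt1 R e_minus \<union> XXt2 w R r C e_minus \<and>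
      {Xt \<in> (XXt0 TYPE('k) :: ('n, 'm) rmat set). \<not> covered w R r C (with_ones Xt)}
        \<in> null_sets lebesgue \<and>
      - (XXt0 TYPE('k) :: ('n, 'm) rmat set) \<in> null_sets lebesgue"
proof -
  let ?X = "with_ones :: ('n, 'm) rmat \<Rightarrow> ('n, 'k) rmat"
  have indep: "(XXt2 w R r C e :: ('n, 'm) rmat set)
      = {Xt \<in> XXt0 TYPE('k) - XXt1 R e. \<forall>\<mu> \<in> M0 (with_ones Xt) R r. T_stat w R r (with_ones Xt) (e + \<mu>) = C}"
    for e :: "'n rvec"
    unfolding XXt2_def
    by (intro Collect_cong conj_cong refl T_stat_eq_for_all_M0_iff[OF _ R]) (auto simp: XXt0_def)
  obtain Xt :: "('n, 'm) rmat" and c where Xt: "rank (?X Xt) = CARD('k)"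
    "beta_hat (?X Xt) e_minus = c *\<^sub>R axis (idx 1) 1" "\<And>t. u_hat (?X Xt) e_minus $ t \<noteq> 0"
    using orthonormal_design_with_ones assms(1) k by blast
  have "R *v beta_hat (?X Xt) e_minus = 0"
    using R1 by (simp add: Xt(2) matrix_vector_mult_scaleR matrix_vector_mult_basis)
  note neg = negligible_exceptional_designs[where F = ?X,
      OF real_polynomial_function_with_ones R \<open>0 < C\<close> w Xt(1) this Xt(3)]
  have null1: "(XXt1 R e_minus :: ('n, 'm) rmat set) \<in> null_sets lebesgue"
    unfolding negligible_iff_null_sets[symmetric]
    by (rule negligible_subset[OF neg(2)]) (auto simp: XXt0_def XXt1_def)
  have null2: "(XXt2 w R r C e_minus :: ('n, 'm) rmat set) \<in> null_sets lebesgue"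
    unfolding negligible_iff_null_sets[symmetric]
    by (rule negligible_subset[OF neg(3)[of r]]) (auto simp: XXt0_def XXt1_def XXt2_def rank_less_iff)
  have null0: "- (XXt0 TYPE('k) :: ('n, 'm) rmat set) \<in> null_sets lebesgue"
    unfolding negligible_iff_null_sets[symmetric]
    by (rule negligible_subset[OF neg(1)]) (auto simp: XXt0_def)
  have sub: "{Xt \<in> XXt0 TYPE('k). \<not> covered w R r C (?X Xt)} \<subseteq> XXt1 R e_minus \<union> XXt2 w R r C e_minus"
    using not_covered_imp_exceptional[OF _ R, where e = e_minus]
    unfolding XXt0_def XXt1_def XXt2_def by blast
  have "negligible (XXt1 R e_minus \<union> XXt2 w R r C e_minus :: ('n, 'm) rmat set)"
    using null1 null2 by (simp add: negligible_iff_null_sets null_sets.Un)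
  then have cov: "{Xt \<in> XXt0 TYPE('k). \<not> covered w R r C (?X Xt)} \<in> null_sets lebesgue"
    using negligible_subset[OF _ sub] by (simp add: negligible_iff_null_sets)
  have "(XXt1 R e_plus :: ('n, 'm) rmat set) = XXt0 TYPE('k)"
    unfolding XXt1_def XXt0_def by (auto simp: B_mat_with_ones_e_plus)
  then have plus: "(XXt1 R e_plus :: ('n, 'm) rmat set) = XXt0 TYPE('k)"
    "(XXt2 w R r C e_plus :: ('n, 'm) rmat set) = {}"
    unfolding XXt2_def by auto
  show ?thesis
    by (intro conjI ballI; rule indep null1 null2 null0 sub cov plus)
qed

text \<open>The vector \<open>e_plus\<close> is itself a regressor, so its residual and hence \<open>B\<close> vanish, while
  \<open>R\<close> applied to its coefficient vector is the first column of \<open>R\<close>: the third alternative applies.\<close>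

lemma covered_with_ones:
  fixes R :: "('q::finite, 'k::{finite,linorder}) rmat"
    and Xt :: "('n::{finite,linorder}, 'm::{finite,linorder}) rmat"
  assumes X: "rank (with_ones Xt :: ('n, 'k) rmat) = CARD('k)"
    and "column (idx 1) R \<noteq> 0" and "rank_condition (with_ones Xt :: ('n, 'k) rmat) R"
  shows "covered w R r C (with_ones Xt :: ('n, 'k) rmat)"
proof -
  have "R *v beta_hat (with_ones Xt :: ('n, 'k) rmat) e_plus \<noteq> 0"
    using assms(2) by (simp add: beta_hat_with_ones_e_plus[OF X] matrix_vector_mult_basis)
  then show ?thesis
    using X assms(3) B_mat_with_ones_e_plus[OF X, of R] unfolding covered_def by blast
qed

theorem proposition3p6:
  fixes \<CC> :: "('n::{finite,linorder}, 'n) rmat set"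
    and R :: "('q::finite, 'k::{finite,linorder}) rmat"
    and r :: "'q rvec"
    and C :: real
    and w :: "int \<Rightarrow> real"
  assumes "CARD('k) < CARD('n)"
    and "covariance_model \<CC>"
    and "ar1_model \<subseteq> \<CC>"
    and "rank R = CARD('q)"
    and "0 < C"
    and "admissible_weights TYPE('n) w"
  shows
    "(\<comment> \<open>item 1\<close>
      (\<forall>e \<in> {e_plus, e_minus :: 'n rvec}.
         XX2 w R r C e
           = {X \<in> XX0 - XX1 R e. \<forall>\<mu> \<in> M0 X R r. T_stat w R r X (e + \<mu>) = C} \<and>
         XX1 R e \<in> null_sets lebesgue \<and>
         XX2 w R r C e \<in> null_sets lebesgue) \<and>
      {X \<in> XX0. \<not> covered w R r C X}
        \<subseteq> (XX1 R (e_plus :: 'n rvec) \<union> XX2 w R r C e_plus) \<inter> (XX1 R e_minus \<union> XX2 w R r C e_minus) \<and>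
      {X \<in> (XX0 :: ('n, 'k) rmat set). \<not> covered w R r C X} \<in> null_sets lebesgue \<and>
      - (XX0 :: ('n, 'k) rmat set) \<in> null_sets lebesgue)
     \<and>
     (\<comment> \<open>item 2\<close>
      2 \<le> CARD('k) \<and> CARD('m::{finite,linorder}) = CARD('k) - 1 \<and> column (idx 1) R = 0 \<longrightarrow>
      (\<forall>e \<in> {e_plus, e_minus :: 'n rvec}.
         (XXt2 w R r C e :: ('n, 'm) rmat set)
           = {Xt \<in> XXt0 TYPE('k) - XXt1 R e.
                \<forall>\<mu> \<in> M0 (with_ones Xt) R r. T_stat w R r (with_ones Xt) (e + \<mu>) = C}) \<and>
      (XXt1 R e_minus :: ('n, 'm) rmat set) \<in> null_sets lebesgue \<and>
      (XXt2 w R r C e_minus :: ('n, 'm) rmat set) \<in> null_sets lebesgue \<and>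
      (XXt1 R e_plus :: ('n, 'm) rmat set) = XXt0 TYPE('k) \<and>
      (XXt2 w R r C e_plus :: ('n, 'm) rmat set) = {} \<and>
      {Xt \<in> (XXt0 TYPE('k) :: ('n, 'm) rmat set). \<not> covered w R r C (with_ones Xt)}
        \<subseteq> XXt1 R e_minus \<union> XXt2 w R r C e_minus \<and>
      {Xt \<in> (XXt0 TYPE('k) :: ('n, 'm) rmat set). \<not> covered w R r C (with_ones Xt)}
        \<in> null_sets lebesgue \<and>
      - (XXt0 TYPE('k) :: ('n, 'm) rmat set) \<in> null_sets lebesgue)
     \<and>
     (\<comment> \<open>item 3\<close>
      2 \<le> CARD('k) \<and> CARD('m) = CARD('k) - 1 \<and> column (idx 1) R \<noteq> 0 \<longrightarrow>
      (\<forall>Xt \<in> (XXt0 TYPE('k) :: ('n, 'm) rmat set).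
         rank_condition (with_ones Xt :: ('n, 'k) rmat) R \<longrightarrow> covered w R r C (with_ones Xt)))"
proof (rule conjI[OF _ conjI], goal_cases)
  case 1
  show ?case
    by (rule exceptional_designs[OF assms(1,4,5,6)])
next
  case 2
  show ?case
    by (intro impI, elim conjE) (rule exceptional_designs_with_ones[OF assms(1,4,5,6)])
next
  case 3
  show ?case
    by (auto simp: XXt0_def intro: covered_with_ones)
qed

end
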